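(* For $k\ge1$ let $M_k$ be the number of Motzkin trees with $k$ vertices. For $n,k\ge1$ let $t_{n,k}$ be the total number, over all Motzkin trees with $n$ vertices, of vertices having a subtree of size $k$. Then: (i) for every $k\ge1$, $$\sum_{n\ge1}t_{n,k}x^n=\frac{M_kx^k}{\sqrt{1-2x-3x^2}};$$ (ii) for every $k\ge1$, the probability that a uniformly random vertex, among all vertices of all Motzkin trees with $n$ vertices, has a subtree of size $k$ (namely $t_{n,k}/(nM_n)$) tends to $M_k\left(\frac13\right)^k$ as $n\to\infty$; (iii) $\displaystyle\sum_{k\ge1}M_k\left(\frac13\right)^k=1$.
   Context: A Motzkin tree is a finite nonempty rooted plane tree (the children of each vertex are linearly ordered) in which every vertex has at most two children; a single child carries no left/right distinction. Trees are counted up to isomorphism of rooted plane trees. A vertex $v$ has a subtree of size $k$ if the subtree consisting of $v$ and all its descendants has exactly $k$ vertices. $\sqrt{1-2x-3x^2}$ denotes the formal power series square root with constant term $1$. *)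

theory Defs
  imports "HOL-Probability.Probability" "HOL-Library.Sublist"
    "HOL-Computational_Algebra.Formal_Power_Series"
begin

text \<open>
  Each isomorphism class of finite nonempty rooted plane trees is represented by exactly one
  element of the following type (the list gives the children of the root, in order).
\<close>

datatype plane_tree = Node "plane_tree list"

fun motzkin :: "plane_tree \<Rightarrow> bool" where
  "motzkin (Node ts) \<longleftrightarrow> length ts \<le> 2 \<and> (\<forall>t \<in> set ts. motzkin t)"

text \<open>
  A vertex is identified with the path leading to it from the root: the list of the
  (zero-based) positions of the children to descend to.
\<close>

fun is_vertex :: "plane_tree \<Rightarrow> nat list \<Rightarrow> bool" where
  "is_vertex t [] \<longleftrightarrow> True"
| "is_vertex (Node ts) (i # p) \<longleftrightarrow> i < length ts \<and> is_vertex (ts ! i) p"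

definition vertices :: "plane_tree \<Rightarrow> nat list set" where
  "vertices t = {v. is_vertex t v}"

text \<open>The descendants of a vertex, itself included, are the vertices whose path extends its path.\<close>

definition subtree_size :: "plane_tree \<Rightarrow> nat list \<Rightarrow> nat" where
  "subtree_size t v = card {w \<in> vertices t. prefix v w}"

definition motzkin_trees :: "nat \<Rightarrow> plane_tree set" where
  "motzkin_trees n = {t. motzkin t \<and> card (vertices t) = n}"

definition M :: "nat \<Rightarrow> nat" where
  "M k = card (motzkin_trees k)"

definition total_count :: "nat \<Rightarrow> nat \<Rightarrow> nat" where
  "total_count n k = (\<Sum>t \<in> motzkin_trees n. card {v \<in> vertices t. subtree_size t v = k})"

definition random_vertex :: "nat \<Rightarrow> (plane_tree \<times> nat list) pmf" where
  "random_vertex n = pmf_of_set (SIGMA t : motzkin_trees n. vertices t)"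

text \<open>The constant term of this square root is \<open>root 2 1 = 1\<close>.\<close>

definition sqrt_series :: "real fps" where
  "sqrt_series = fps_radical root 2 (1 - 2 * fps_X - 3 * fps_X ^ 2)"

end

(*
  Splitting a tree at its root gives M = x (1 + M + M^2) and, for the series T of the t_{n,k},
  T = M_k x^k + x (T + 2 M T).  Since 1 - x - 2 x M squares to 1 - 2 x - 3 x^2, the second equation
  is T S = M_k x^k with S the square root.  Hence t_{n,k} = M_k c_{n-k} for the coefficients c_n of
  1/S, and 2 n M_n = c_{n+1} - c_n follows by differentiating the equation for M; the limit in (ii)
  then only needs c_{n+1} / c_n -> 3, read off the three-term recurrence of c.  For (iii), the
  equation for M at x = 1/3 bounds the partial sums by 1 and forces (s - 1)^2 = 0 for the sum s.
*)
theory Submission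
  imports Defs "HOL-Real_Asymp.Real_Asymp"
begin

unbundle no vec_syntax
unbundle fps_syntax

section \<open>Decomposition at the root\<close>

lemma vertices_Node:
  "vertices (Node ts) = insert [] (\<Union>i<length ts. Cons i ` vertices (ts ! i))"
proof -
  have "is_vertex (Node ts) v \<longleftrightarrow> v \<in> insert [] (\<Union>i<length ts. Cons i ` vertices (ts ! i))" for v
    by (cases v) (auto simp: vertices_def)
  then show ?thesis by (auto simp: vertices_def)
qed

lemma finite_vertices: "finite (vertices t)"
proof (induction t)
  case (Node ts)
  then show ?case by (simp add: vertices_Node)
qed

lemma card_vertices_pos: "card (vertices t) > 0"
  by (cases t) (metis card_gt_0_iff empty_iff finite_vertices insertI1 vertices_Node)

text \<open>A vertex is the root or \<open>i # v\<close> with \<open>v\<close> a vertex of child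
  \<open>i\<close>. \<open>P\<close> is left open because tree sizes and vertices of prescribed
  subtree size are both counted this way.\<close>

lemma card_root_decomposition:
  "card {v \<in> vertices (Node ts). P v}
   = of_bool (P []) + (\<Sum>i<length ts. card {v \<in> vertices (ts ! i). P (i # v)})"
proof -
  have "{v \<in> vertices (Node ts). P v}
      = (if P [] then {[]} else {}) \<union> (\<Union>i<length ts. Cons i ` {v \<in> vertices (ts ! i). P (i # v)})"
    by (auto simp: vertices_Node)
  also have "card \<dots> = card (if P [] then {[] :: nat list} else {})
      + card (\<Union>i<length ts. Cons i ` {v \<in> vertices (ts ! i). P (i # v)})"
    by (rule card_Un_disjoint) (auto simp: finite_vertices)
  also have "card (\<Union>i<length ts. Cons i ` {v \<in> vertices (ts ! i). P (i # v)})
      = (\<Sum>i<length ts. card (Cons i ` {v \<in> vertices (ts ! i). P (i # v)}))"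
    by (rule card_UN_disjoint) (auto simp: finite_vertices)
  also have "\<dots> = (\<Sum>i<length ts. card {v \<in> vertices (ts ! i). P (i # v)})"
    by (simp add: card_image)
  finally show ?thesis by simp
qed

lemma card_vertices_Node:
  "card (vertices (Node ts)) = Suc (\<Sum>i<length ts. card (vertices (ts ! i)))"
  using card_root_decomposition[of ts "\<lambda>_. True"] by simp

lemma subtree_size_Nil: "subtree_size t [] = card (vertices t)"
  by (simp add: subtree_size_def)

lemma subtree_size_Cons:
  assumes "i < length ts"
  shows "subtree_size (Node ts) (i # v) = subtree_size (ts ! i) v"
proof -
  have "{w \<in> vertices (Node ts). prefix (i # v) w} = Cons i ` {w \<in> vertices (ts ! i). prefix v w}"
    using assms by (auto simp: vertices_Node)
  then show ?thesis by (simp add: subtree_size_def card_image)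
qed

definition vertex_count :: "nat \<Rightarrow> plane_tree \<Rightarrow> nat" where
  "vertex_count k t = card {v \<in> vertices t. subtree_size t v = k}"

lemma vertex_count_Node:
  "vertex_count k (Node ts)
   = of_bool (card (vertices (Node ts)) = k) + (\<Sum>i<length ts. vertex_count k (ts ! i))"
  unfolding vertex_count_def card_root_decomposition
  by (simp add: subtree_size_Nil subtree_size_Cons)

section \<open>Motzkin trees of a given size\<close>

lemma motzkin_trees_0: "motzkin_trees 0 = {}"
  using card_vertices_pos by (auto simp: motzkin_trees_def)

lemma Node_in_motzkin_trees_Suc:
  "Node [] \<in> motzkin_trees (Suc n) \<longleftrightarrow> n = 0"
  "Node [t] \<in> motzkin_trees (Suc n) \<longleftrightarrow> t \<in> motzkin_trees n"
  "Node [t, u] \<in> motzkin_trees (Suc n)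
    \<longleftrightarrow> (\<exists>i\<le>n. t \<in> motzkin_trees i \<and> u \<in> motzkin_trees (n - i))"
proof -
  show "Node [] \<in> motzkin_trees (Suc n) \<longleftrightarrow> n = 0" "Node [t] \<in> motzkin_trees (Suc n) \<longleftrightarrow> t \<in> motzkin_trees n"
    by (auto simp: motzkin_trees_def card_vertices_Node)
  have "card (vertices (Node [t, u])) = Suc (card (vertices t) + card (vertices u))"
    by (simp add: card_vertices_Node lessThan_Suc)
  then show "Node [t, u] \<in> motzkin_trees (Suc n)
    \<longleftrightarrow> (\<exists>i\<le>n. t \<in> motzkin_trees i \<and> u \<in> motzkin_trees (n - i))"
    unfolding motzkin_trees_def by auto
qed

text \<open>The size \<open>i\<close> of the first subtree indexes the binary case, so that sums
  over it become convolutions. The ends \<open>i = 0\<close> and \<open>i = n\<close> contribute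
  nothing, since \<open>motzkin_trees 0\<close> is empty.\<close>

lemma motzkin_trees_Suc:
  "motzkin_trees (Suc n) = (if n = 0 then {Node []} else {})
     \<union> (\<lambda>t. Node [t]) ` motzkin_trees n
     \<union> (\<lambda>(i, t, u). Node [t, u]) ` (SIGMA i:{..n}. motzkin_trees i \<times> motzkin_trees (n - i))"
  (is "?L = ?R")
proof (intro set_eqI iffI)
  fix s assume s: "s \<in> ?L"
  obtain ts where ts: "s = Node ts" by (cases s)
  have "length ts \<le> 2"
    using s ts by (simp add: motzkin_trees_def)
  then consider "ts = []" | t where "ts = [t]" | t u where "ts = [t, u]"
    by (auto simp: le_Suc_eq numeral_2_eq_2 length_Suc_conv)
  then show "s \<in> ?R"
  proof cases
    case 1
    then show ?thesis using s ts by (simp add: Node_in_motzkin_trees_Suc)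
  next
    case (2 t)
    then show ?thesis using s ts by (simp add: Node_in_motzkin_trees_Suc)
  next
    case (3 t u)
    then obtain i where "i \<le> n" "t \<in> motzkin_trees i" "u \<in> motzkin_trees (n - i)"
      using s ts Node_in_motzkin_trees_Suc(3) by blast
    then have "(i, t, u) \<in> (SIGMA i:{..n}. motzkin_trees i \<times> motzkin_trees (n - i))"
      by simp
    from imageI[OF this, of "\<lambda>(i, t, u). Node [t, u]"] show ?thesis
      using ts 3 by simp
  qed
next
  fix s assume "s \<in> ?R"
  then show "s \<in> ?L"
    by (auto simp: Node_in_motzkin_trees_Suc split: if_splits)
qed

lemma finite_motzkin_trees: "finite (motzkin_trees n)"
proof (induction n rule: less_induct)
  case (less n)
  show ?case
  proof (cases n)
    case (Suc m)
    then show ?thesis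
      using less by (auto simp: motzkin_trees_Suc less_Suc_eq_le intro!: finite_imageI finite_SigmaI)
  qed (simp add: motzkin_trees_0)
qed

text \<open>A constant weight yields the recurrence for \<open>M\<close>; counting the vertices
  below the root yields the one for \<open>total_count\<close>.\<close>

lemma sum_motzkin_trees_Suc:
  fixes w :: "plane_tree \<Rightarrow> 'a :: comm_monoid_add"
  shows "(\<Sum>t\<in>motzkin_trees (Suc n). w t) = (if n = 0 then w (Node []) else 0)
    + (\<Sum>t\<in>motzkin_trees n. w (Node [t]))
    + (\<Sum>i\<le>n. \<Sum>t\<in>motzkin_trees i. \<Sum>u\<in>motzkin_trees (n - i). w (Node [t, u]))"
proof -
  let ?S = "SIGMA i:{..n}. motzkin_trees i \<times> motzkin_trees (n - i)"
  \<comment> \<open>The index \<open>i\<close> is the size of \<open>t\<close>, so no tree is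
    counted twice.\<close>
  have inj: "inj_on (\<lambda>(i, t, u). Node [t, u]) ?S"
    by (auto simp: inj_on_def motzkin_trees_def)
  have fin: "finite ?S" by (auto simp: finite_motzkin_trees)
  have "(\<Sum>t\<in>motzkin_trees (Suc n). w t) = sum w (if n = 0 then {Node []} else {})
      + sum w ((\<lambda>t. Node [t]) ` motzkin_trees n) + sum w ((\<lambda>(i, t, u). Node [t, u]) ` ?S)"
    unfolding motzkin_trees_Suc
    by (subst sum.union_disjoint; (subst sum.union_disjoint)?)
       (use fin in \<open>auto simp: finite_motzkin_trees split: if_splits\<close>)
  also have "sum w ((\<lambda>(i, t, u). Node [t, u]) ` ?S) = (\<Sum>(i, t, u)\<in>?S. w (Node [t, u]))"
    by (subst sum.reindex[OF inj]) (simp add: case_prod_unfold)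
  also have "\<dots> = (\<Sum>i\<le>n. \<Sum>(t, u)\<in>motzkin_trees i \<times> motzkin_trees (n - i). w (Node [t, u]))"
    by (subst sum.Sigma) (auto simp: finite_motzkin_trees case_prod_unfold)
  also have "\<dots> = (\<Sum>i\<le>n. \<Sum>t\<in>motzkin_trees i. \<Sum>u\<in>motzkin_trees (n - i). w (Node [t, u]))"
    by (simp add: sum.cartesian_product)
  also have "sum w ((\<lambda>t. Node [t]) ` motzkin_trees n) = (\<Sum>t\<in>motzkin_trees n. w (Node [t]))"
    by (subst sum.reindex) (auto simp: inj_on_def)
  finally show ?thesis by simp
qed

section \<open>Recurrences for the two counts\<close>

lemma M_0: "M 0 = 0"
  by (simp add: M_def motzkin_trees_0)

lemma M_Suc: "M (Suc n) = of_bool (n = 0) + M n + (\<Sum>i\<le>n. M i * M (n - i))"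
  using sum_motzkin_trees_Suc[of "\<lambda>_. 1 :: nat" n] by (simp add: M_def)

lemma M_pos: "n \<ge> 1 \<Longrightarrow> M n > 0"
  by (induction n rule: dec_induct) (simp_all add: M_Suc)

lemma total_count_0: "total_count 0 k = 0"
  by (simp add: total_count_def motzkin_trees_0)

text \<open>The root counts exactly when the whole tree has \<open>k\<close> vertices; the other
  counted vertices lie in the children. A binary root gives one convolution per child, and
  reflecting the index shows them equal, hence the factor 2.\<close>

lemma total_count_Suc:
  "total_count (Suc n) k = of_bool (Suc n = k) * M k + total_count n k
     + 2 * (\<Sum>i\<le>n. M i * total_count (n - i) k)"
proof -
  have tc: "total_count m k = (\<Sum>t\<in>motzkin_trees m. vertex_count k t)" for m
    by (simp add: total_count_def vertex_count_def)
  define w where "w t = (case t of Node ts \<Rightarrow> (\<Sum>i<length ts. vertex_count k (ts ! i)))" for t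
  have vc: "vertex_count k t = of_bool (card (vertices t) = k) + w t" for t
    by (cases t) (simp add: vertex_count_Node w_def)
  have "(\<Sum>t\<in>motzkin_trees (Suc n). of_bool (card (vertices t) = k)) = of_bool (Suc n = k) * M k"
    by (subst sum.cong[OF refl, where h = "\<lambda>_. of_bool (Suc n = k)"])
       (auto simp: motzkin_trees_def M_def)
  moreover have "(\<Sum>t\<in>motzkin_trees (Suc n). w t) = total_count n k
      + (\<Sum>i\<le>n. total_count i k * M (n - i) + M i * total_count (n - i) k)"
    unfolding sum_motzkin_trees_Suc
    by (simp add: w_def tc sum.distrib lessThan_Suc M_def sum_distrib_left mult.commute add.commute)
  moreover have "(\<Sum>i\<le>n. total_count i k * M (n - i)) = (\<Sum>i\<le>n. M i * total_count (n - i) k)"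
    by (rule sum.reindex_bij_witness[of _ "\<lambda>i. n - i" "\<lambda>i. n - i"]) auto
  moreover have "total_count (Suc n) k
      = (\<Sum>t\<in>motzkin_trees (Suc n). of_bool (card (vertices t) = k)) + (\<Sum>t\<in>motzkin_trees (Suc n). w t)"
    by (simp add: tc vc sum.distrib)
  ultimately show ?thesis by (simp add: sum.distrib)
qed


section \<open>Generating functions\<close>

definition M_fps :: "real fps" where
  "M_fps = Abs_fps (\<lambda>n. real (M n))"

definition count_fps :: "nat \<Rightarrow> real fps" where
  "count_fps k = Abs_fps (\<lambda>n. real (total_count n k))"

lemma M_fps_nth [simp]: "M_fps $ n = real (M n)"
  by (simp add: M_fps_def)

lemma count_fps_nth [simp]: "count_fps k $ n = real (total_count n k)"
  by (simp add: count_fps_def)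

lemma fps_numeral_mult_nth: "(numeral m * f) $ n = numeral m * (f $ n :: 'a :: comm_ring_1)"
  by (simp add: numeral_fps_const)

lemma M_fps_eq: "M_fps = fps_X * (1 + M_fps + M_fps\<^sup>2)"
proof (rule fps_ext)
  fix n
  have "(M_fps\<^sup>2) $ m = (\<Sum>i\<le>m. real (M i) * real (M (m - i)))" for m
    by (simp add: power2_eq_square fps_mult_nth atLeast0AtMost)
  then show "M_fps $ n = (fps_X * (1 + M_fps + M_fps\<^sup>2)) $ n"
    by (cases n) (simp_all only: fps_X_mult_nth fps_add_nth M_fps_nth M_0 M_Suc, simp_all)
qed

lemma count_fps_eq:
  assumes "k \<ge> 1"
  shows "count_fps k
    = fps_const (real (M k)) * fps_X ^ k + fps_X * (count_fps k + 2 * (M_fps * count_fps k))"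
proof (rule fps_ext)
  fix n
  have conv: "(M_fps * count_fps k) $ m = real (\<Sum>i\<le>m. M i * total_count (m - i) k)" for m
    by (simp add: fps_mult_nth atLeast0AtMost)
  show "count_fps k $ n
    = (fps_const (real (M k)) * fps_X ^ k + fps_X * (count_fps k + 2 * (M_fps * count_fps k))) $ n"
  proof (cases n)
    case 0
    then show ?thesis using assms by (simp add: total_count_0)
  next
    case (Suc m)
    have "(fps_const (real (M k)) * fps_X ^ k) $ n = of_bool (n = k) * real (M k)"
      by simp
    moreover have "(fps_X * (count_fps k + 2 * (M_fps * count_fps k))) $ n
        = real (total_count m k) + 2 * real (\<Sum>i\<le>m. M i * total_count (m - i) k)"
      unfolding Suc fps_X_mult_nth fps_add_nth fps_numeral_mult_nth conv by simp
    ultimately show ?thesis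
      unfolding fps_add_nth count_fps_nth Suc total_count_Suc by simp
  qed
qed

section \<open>The square root and the closed form of the counts\<close>

lemma sqrt_series_square: "sqrt_series\<^sup>2 = 1 - 2 * fps_X - 3 * fps_X\<^sup>2"
  and sqrt_series_0: "sqrt_series $ 0 = 1"
proof -
  have "(1 - 2 * fps_X - 3 * fps_X\<^sup>2 :: real fps) $ 0 = 1"
    by simp
  then show "sqrt_series\<^sup>2 = 1 - 2 * fps_X - 3 * fps_X\<^sup>2" "sqrt_series $ 0 = 1"
    using power_radical[of "1 - 2 * fps_X - 3 * fps_X\<^sup>2 :: real fps" root 1]
    by (simp_all add: sqrt_series_def numeral_2_eq_2)
qed

text \<open>Equal squares in an integral domain agree up to sign, and the constant term 1 settles
  the sign.\<close>

lemma sqrt_series_eq: "sqrt_series = 1 - fps_X - 2 * fps_X * M_fps"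
proof -
  let ?D = "1 - fps_X - 2 * fps_X * M_fps"
  \<comment> \<open>The square of \<open>?D\<close> is (1 - x)^2 - 4x (M - x M - x M^2), and the
    bracket equals x by \<open>M_fps_eq\<close>.\<close>
  have "?D\<^sup>2 = sqrt_series\<^sup>2"
    using M_fps_eq unfolding sqrt_series_square by algebra
  then have "?D = sqrt_series \<or> ?D = - sqrt_series"
    by (simp add: power2_eq_iff)
  moreover have "?D $ 0 \<noteq> (- sqrt_series) $ 0"
    by (simp add: sqrt_series_0)
  ultimately show ?thesis by metis
qed

lemma count_fps_closed_form:
  assumes "k \<ge> 1"
  shows "count_fps k = fps_const (real (M k)) * fps_X ^ k / sqrt_series"
proof -
  \<comment> \<open>Stated for arbitrary series so that \<open>algebra\<close> works with plain
    variables.\<close>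
  have "f * (1 - x - 2 * x * m) = c" if "f = c + x * (f + 2 * (m * f))" for f c x m :: "real fps"
    using that by algebra
  from this[OF count_fps_eq[OF assms]]
  have "count_fps k * sqrt_series = fps_const (real (M k)) * fps_X ^ k"
    unfolding sqrt_series_eq .
  moreover have "sqrt_series \<noteq> 0"
    using sqrt_series_0 by auto
  ultimately show ?thesis
    by (metis nonzero_mult_div_cancel_right)
qed


section \<open>Asymptotics\<close>

text \<open>The coefficients of \<open>1 / sqrt_series\<close> are the central trinomial coefficients.\<close>

definition trinomial :: "nat \<Rightarrow> real" where
  "trinomial n = inverse sqrt_series $ n"

lemma inverse_sqrt_series: "sqrt_series * inverse sqrt_series = 1"
  using inverse_mult_eq_1[of sqrt_series] sqrt_series_0 by (simp add: mult.commute)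

lemma total_count_eq:
  assumes "k \<ge> 1" "n \<ge> k"
  shows "real (total_count n k) = real (M k) * trinomial (n - k)"
proof -
  have "count_fps k = fps_const (real (M k)) * (fps_X ^ k * inverse sqrt_series)"
    using count_fps_closed_form[OF assms(1)] sqrt_series_0
    by (simp add: fps_divide_unit mult.assoc)
  then have "count_fps k $ n = real (M k) * trinomial (n - k)"
    using assms by (simp add: trinomial_def fps_X_power_mult_nth)
  then show ?thesis by (simp add: count_fps_def)
qed

section \<open>Recurrence for the central trinomial coefficients\<close>

lemma trinomial_0: "trinomial 0 = 1"
  by (simp add: trinomial_def sqrt_series_0)

text \<open>With C the inverse square root and P = 1 - 2x - 3x^2, differentiate C^2 P = 1 and cancel
  2C. The resulting linear differential equation encodes a recurrence for the coefficients of
  C.\<close>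

lemma trinomial_deriv:
  "(1 - 2 * fps_X - 3 * fps_X\<^sup>2) * fps_deriv (inverse sqrt_series)
   = (1 + 3 * fps_X) * inverse sqrt_series"
proof -
  let ?C = "inverse sqrt_series" and ?P = "1 - 2 * fps_X - 3 * fps_X\<^sup>2 :: real fps"
  have "?C\<^sup>2 * ?P = (sqrt_series * ?C)\<^sup>2"
    unfolding sqrt_series_square[symmetric] power_mult_distrib by (rule mult.commute)
  then have CP: "?C\<^sup>2 * ?P = 1"
    by (simp only: inverse_sqrt_series power_one)
  have P': "fps_deriv ?P = - 2 - 6 * fps_X"
    by (simp add: power2_eq_square fps_deriv_mult numeral_fps_const algebra_simps)
  have "fps_deriv (?C\<^sup>2 * ?P) = 0" unfolding CP by simp
  then have deriv_eq: "?C * ?C * (- 2 - 6 * fps_X) + (?C * fps_deriv ?C + fps_deriv ?C * ?C) * ?P = 0"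
    by (simp only: fps_deriv_mult P' power2_eq_square[of ?C])
  have "2 * c * (p * d - (1 + 3 * x) * c) = 0"
    if "c * c * (- 2 - 6 * x) + (c * d + d * c) * p = 0" for c d p x :: "real fps"
    using that by (simp add: algebra_simps)
  from this[OF deriv_eq] have "2 * ?C * (?P * fps_deriv ?C - (1 + 3 * fps_X) * ?C) = 0" .
  moreover have "?C \<noteq> 0" by (simp add: sqrt_series_0)
  ultimately show ?thesis by (metis mult_eq_0_iff right_minus_eq zero_neq_numeral)
qed

lemma trinomial_1: "trinomial 1 = 1"
  using arg_cong[OF trinomial_deriv, of "\<lambda>f. f $ 0"] by (simp add: trinomial_def sqrt_series_0)

lemma trinomial_rec:
  "(real n + 2) * trinomial (n + 2) = (2 * real n + 3) * trinomial (n + 1) + 3 * (real n + 1) * trinomial n"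
proof -
  let ?C = "inverse sqrt_series"
  \<comment> \<open>Products with \<open>fps_X\<close> shift indices. The double shift reaches
    coefficient \<open>n - 1\<close> of the derivative, so \<open>n = 0\<close> is treated
    apart.\<close>
  have "fps_deriv ?C - 2 * (fps_X * fps_deriv ?C) - 3 * (fps_X * (fps_X * fps_deriv ?C))
      = ?C + 3 * (fps_X * ?C)"
    using trinomial_deriv by (simp add: algebra_simps power2_eq_square)
  from arg_cong[OF this, of "\<lambda>f. f $ Suc n"] show ?thesis
    by (cases n) (simp_all add: fps_numeral_mult_nth trinomial_def, simp_all add: algebra_simps)
qed

text \<open>Expresses the denominator in (ii) by the coefficients found in the numerator. With S the
  square root and C its inverse, differentiation gives x M' S = M, so x M' = M C, and 2 x M = 1 - x
  - S turns this into 2 x^2 M' = (1 - x) C - 1.\<close>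

lemma M_eq_trinomial_diff:
  "2 * (real n * real (M n)) = trinomial (Suc n) - trinomial n"
proof -
  let ?C = "inverse sqrt_series"
  have "fps_deriv M_fps = fps_deriv (fps_X * (1 + M_fps + M_fps\<^sup>2))"
    using M_fps_eq by simp
  then have "fps_deriv M_fps = 1 + M_fps + M_fps\<^sup>2 + fps_X * (1 + 2 * M_fps) * fps_deriv M_fps"
    by (simp add: fps_deriv_mult power2_eq_square algebra_simps)
  then have "fps_X * fps_deriv M_fps * sqrt_series = M_fps"
    using M_fps_eq unfolding sqrt_series_eq by algebra
  moreover have "2 * (x * (x * d)) = c - x * c - 1"
    if "x * d * s = m" "s * c = 1" "s = 1 - x - 2 * x * m" for x d s m c :: "real fps"
  proof -
    have "x * d = x * d * (s * c)"
      using that(2) by simp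
    also have "\<dots> = m * c"
      by (simp only: that(1)[symmetric] mult.assoc)
    finally have "2 * (x * (x * d)) = (1 - x - s) * c"
      using that(3) by simp
    then show ?thesis
      using that(2) by (simp add: left_diff_distrib)
  qed
  ultimately have "2 * (fps_X * (fps_X * fps_deriv M_fps)) = ?C - fps_X * ?C - 1"
    using inverse_sqrt_series sqrt_series_eq by blast
  \<comment> \<open>The summand -1 affects only the constant coefficient, which the index
    \<open>Suc n\<close> avoids.\<close>
  from arg_cong[OF this, of "\<lambda>f. f $ Suc n"] show ?thesis
    by (cases n) (simp_all add: fps_numeral_mult_nth trinomial_def)
qed


section \<open>Positivity and ratios of the coefficients\<close>

lemma trinomial_pos: "trinomial n > 0"
proof -
  \<comment> \<open>Two neighbours are carried along because the recurrence reaches back two steps,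
    with positive coefficients.\<close>
  have "trinomial n > 0 \<and> trinomial (Suc n) > 0"
  proof (induction n)
    case 0
    then show ?case using trinomial_0 trinomial_1 by simp
  next
    case (Suc n)
    then have "(real n + 2) * trinomial (n + 2) > 0"
      unfolding trinomial_rec by (intro add_pos_pos[OF mult_pos_pos mult_pos_pos]) auto
    then have "trinomial (n + 2) > 0" by (rule zero_less_mult_pos) simp
    then show ?case using Suc by simp
  qed
  then show ?thesis ..
qed

text \<open>
  The recurrence turns the ratio \<open>r\<close> of consecutive coefficients into
  \<open>2 + 3 / r + O(1 / n)\<close>, which contracts towards the fixed point \<open>3\<close>.
\<close>

lemma trinomial_ratio_tendsto: "(\<lambda>n. trinomial (Suc n) / trinomial n) \<longlonglongrightarrow> 3"
proof -
  define r where "r n = trinomial (Suc n) / trinomial n" for n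
  have rec: "r (Suc n) = (2 * real n + 3 + (real n + 1) * (3 / r n)) / (real n + 2)" for n
  proof -
    have tri: "trinomial (n + 2)
        = ((2 * real n + 3) * trinomial (n + 1) + 3 * (real n + 1) * trinomial n) / (real n + 2)"
      using trinomial_rec[of n] by (simp add: field_simps)
    have key: "(p * b + 3 * q * a) / m / b = (p + q * (3 / (b / a))) / m"
      if "a > 0" "b > 0" "m > 0" for a b m p q :: real
      using that by (simp add: field_simps)
    from tri have "r (Suc n) = ((2 * real n + 3) * trinomial (n + 1) + 3 * (real n + 1) * trinomial n)
        / (real n + 2) / trinomial (n + 1)"
      by (simp only: r_def add_2_eq_Suc' Suc_eq_plus1[symmetric])
    moreover have "((2 * real n + 3) * trinomial (n + 1) + 3 * (real n + 1) * trinomial n)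
        / (real n + 2) / trinomial (n + 1)
      = (2 * real n + 3 + (real n + 1) * (3 / (trinomial (n + 1) / trinomial n))) / (real n + 2)"
      by (rule key[OF trinomial_pos trinomial_pos]) simp
    ultimately show ?thesis
      by (simp only: r_def Suc_eq_plus1)
  qed
  \<comment> \<open>The estimates start at index 1, where the ratio is exactly 3;
    \<open>r 0 = 1\<close> lies outside the interval used below.\<close>
  have r1: "r 1 = 3"
    using trinomial_rec[of 0] trinomial_0 trinomial_1 by (simp add: r_def numeral_2_eq_2)
  \<comment> \<open>The interval is invariant: \<open>r n \<ge> 2\<close> gives 3 / r <= 3/2 and the
    upper bound, while \<open>r n \<le> 7 / 2\<close> gives 3 / r >= 6/7 and, as n >= 1, the lower
    one.\<close>
  have bounds: "2 \<le> r n \<and> r n \<le> 7 / 2" if "n \<ge> 1" for n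
    using that
  proof (induction n rule: dec_induct)
    case base
    then show ?case using r1 by simp
  next
    case (step n)
    then have n: "real n \<ge> 1" by simp
    have "3 / r n \<le> 3 / 2" "3 / r n \<ge> 6 / 7"
      using step.IH by (simp_all add: field_simps)
    then have "(real n + 1) * (3 / r n) \<le> (real n + 1) * (3 / 2)"
      "(real n + 1) * (3 / r n) \<ge> (real n + 1) * (6 / 7)"
      by (intro mult_left_mono; simp)+
    moreover have "2 \<le> (2 * real n + 3 + z) / (real n + 2)" "(2 * real n + 3 + z) / (real n + 2) \<le> 7 / 2"
      if "z \<le> (real n + 1) * (3 / 2)" "z \<ge> (real n + 1) * (6 / 7)" for z
      using that n by (simp_all add: field_simps)
    ultimately show ?case
      unfolding rec by blast
  qed
  \<comment> \<open>The old error is divided by \<open>r n\<close>, hence at least halved, and at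
    most (5/2) / (n + 2) is added. The induction needs (C/2 + 5/2) / N <= C / (N + 1) for all N = n
    + 2 >= 3; the least such C is 10.\<close>
  have err: "\<bar>r n - 3\<bar> \<le> 10 / (real n + 2)" if "n \<ge> 1" for n
    using that
  proof (induction n rule: dec_induct)
    case base
    then show ?case using r1 by simp
  next
    case (step n)
    have r2: "r n \<ge> 2" using bounds step.hyps by simp
    have split: "(2 * N + 3 + (N + 1) * q) / (N + 2) - 3 = q - 1 - (1 + q) / (N + 2)"
      if "N \<ge> 0" for N q :: real
      using that by (simp add: field_simps)
    have "r (Suc n) - 3 = 3 / r n - 1 - (1 + 3 / r n) / (real n + 2)"
      unfolding rec by (rule split) simp
    moreover have "3 / r n - 1 = - (r n - 3) / r n"
      using r2 by (simp add: field_simps)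
    ultimately have "r (Suc n) - 3 = - (r n - 3) / r n - (1 + 3 / r n) / (real n + 2)"
      by simp
    also have "\<bar>\<dots>\<bar> \<le> \<bar>- (r n - 3) / r n\<bar> + \<bar>(1 + 3 / r n) / (real n + 2)\<bar>"
      by (rule abs_triangle_ineq4)
    also have "\<bar>- (r n - 3) / r n\<bar> \<le> (10 / (real n + 2)) / 2"
      unfolding abs_divide abs_minus_cancel using step.IH r2 by (intro frac_le) auto
    also have "\<bar>(1 + 3 / r n) / (real n + 2)\<bar> = (1 + 3 / r n) / (real n + 2)"
      using r2 by simp
    also have "\<dots> \<le> (5 / 2) / (real n + 2)"
      using r2 by (intro divide_right_mono) (simp_all add: field_simps)
    also have "10 / (real n + 2) / 2 + (5 / 2) / (real n + 2) \<le> 10 / (real (Suc n) + 2)"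
    proof -
      have "10 / N / 2 + (5 / 2) / N \<le> 10 / (N + 1)" if "N \<ge> 3" for N :: real
        using that by (simp add: field_simps)
      from this[of "real n + 2"] show ?thesis
        using step.hyps by (simp add: add.commute)
    qed
    finally show ?case by simp
  qed
  have "(\<lambda>n. 10 / (real n + 2)) \<longlonglongrightarrow> 0"
    by real_asymp
  then have "(\<lambda>n. r n - 3) \<longlonglongrightarrow> 0"
    by (rule Lim_null_comparison[rotated]) (use err in \<open>auto simp: eventually_sequentially\<close>)
  then show ?thesis
    unfolding r_def by (simp add: LIM_zero_iff)
qed

text \<open>The quotient telescopes into \<open>k\<close> reciprocals of consecutive ratios, each
  tending to 1/3.\<close>

lemma trinomial_shift_tendsto: "(\<lambda>n. trinomial n / trinomial (n + k)) \<longlonglongrightarrow> (1 / 3) ^ k"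
proof (induction k)
  case 0
  have "trinomial n / trinomial (n + 0) = 1" for n
    using trinomial_pos[of n] by simp
  then show ?case by simp
next
  case (Suc k)
  have "(\<lambda>n. trinomial (Suc (n + k)) / trinomial (n + k)) \<longlonglongrightarrow> 3"
    using LIMSEQ_ignore_initial_segment[OF trinomial_ratio_tendsto] by simp
  then have "(\<lambda>n. trinomial n / trinomial (n + k) / (trinomial (Suc (n + k)) / trinomial (n + k)))
      \<longlonglongrightarrow> (1 / 3) ^ k / 3"
    by (intro tendsto_divide Suc) auto
  moreover have "trinomial n / trinomial (n + k) / (trinomial (Suc (n + k)) / trinomial (n + k))
      = trinomial n / trinomial (n + Suc k)" for n
    using trinomial_pos[of "n + k"] trinomial_pos[of "Suc (n + k)"] by simp
  ultimately have "(\<lambda>n. trinomial n / trinomial (n + Suc k)) \<longlonglongrightarrow> (1 / 3) ^ k / 3"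
    by (simp only:)
  then show ?case by simp
qed

text \<open>The shift to \<open>n + k\<close> removes the truncated difference in
  \<open>total_count_eq\<close>. Dividing numerator and denominator by
  \<open>trinomial (n + k)\<close> leaves known limits; the 2 from
  \<open>M_eq_trinomial_diff\<close> cancels against 3 - 1.\<close>

lemma vertex_fraction_tendsto:
  assumes "k \<ge> 1"
  shows "(\<lambda>n. real (total_count n k) / (real n * real (M n))) \<longlonglongrightarrow> real (M k) * (1 / 3) ^ k"
proof (rule LIMSEQ_offset)
  let ?r = "\<lambda>n. trinomial (Suc (n + k)) / trinomial (n + k)"
  have "?r \<longlonglongrightarrow> 3"
    using LIMSEQ_ignore_initial_segment[OF trinomial_ratio_tendsto] by simp
  then have "(\<lambda>n. 2 * real (M k) * (trinomial n / trinomial (n + k)) / (?r n - 1))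
      \<longlonglongrightarrow> 2 * real (M k) * (1 / 3) ^ k / (3 - 1)"
    by (intro tendsto_intros trinomial_shift_tendsto) auto
  moreover have "2 * real (M k) * (trinomial n / trinomial (n + k)) / (?r n - 1)
      = real (total_count (n + k) k) / (real (n + k) * real (M (n + k)))" for n
  proof -
    have "?r n - 1 = 2 * (real (n + k) * real (M (n + k))) / trinomial (n + k)"
      unfolding M_eq_trinomial_diff using trinomial_pos[of "n + k"] by (simp add: field_simps)
    then show ?thesis
      using trinomial_pos[of "n + k"] total_count_eq[OF assms, of "n + k"] by simp
  qed
  ultimately show "(\<lambda>n. real (total_count (n + k) k) / (real (n + k) * real (M (n + k))))
      \<longlonglongrightarrow> real (M k) * (1 / 3) ^ k"
    by simp
qed

text \<open>All trees involved have \<open>n\<close> vertices, so the sample space has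
  \<open>n * M n\<close> elements; \<open>M_pos\<close> makes it nonempty, as a uniform distribution
  requires.\<close>

lemma prob_subtree_size:
  assumes "n \<ge> 1"
  shows "measure_pmf.prob (random_vertex n) {(t, v). subtree_size t v = k}
    = real (total_count n k) / (real n * real (M n))"
proof -
  let ?S = "SIGMA t : motzkin_trees n. vertices t"
  have fin: "finite ?S"
    by (simp add: finite_motzkin_trees finite_vertices)
  have "(\<Sum>t\<in>motzkin_trees n. card (vertices t)) = (\<Sum>t\<in>motzkin_trees n. n)"
    by (rule sum.cong) (auto simp: motzkin_trees_def)
  then have card: "card ?S = n * M n"
    by (simp add: finite_motzkin_trees finite_vertices M_def)
  have "card ?S > 0"
    using card assms M_pos[OF assms] by simp
  then have ne: "?S \<noteq> {}"
    by (metis card.empty less_irrefl)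
  have "?S \<inter> {(t, v). subtree_size t v = k}
      = (SIGMA t : motzkin_trees n. {v \<in> vertices t. subtree_size t v = k})"
    by auto
  then have "card (?S \<inter> {(t, v). subtree_size t v = k}) = total_count n k"
    by (simp add: total_count_def finite_motzkin_trees finite_vertices)
  then show ?thesis
    by (simp add: random_vertex_def measure_pmf_of_set[OF ne fin] card)
qed


section \<open>The limiting distribution\<close>

text \<open>At x = 1/3 the discriminant 1 - 2x - 3x^2 of the quadratic for M vanishes, which is why
  1 is a double root.\<close>

lemma M_third_sums: "(\<lambda>k. real (M (Suc k)) * (1 / 3) ^ Suc k) sums 1"
proof -
  define a where "a k = real (M k) * (1 / 3) ^ k" for k
  have a_nonneg: "a k \<ge> 0" for k
    by (simp add: a_def)
  have a_0: "a 0 = 0"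
    by (simp add: a_def M_0)
  have a_Suc: "a (Suc k) = (of_bool (k = 0) + a k + (\<Sum>i\<le>k. a i * a (k - i))) / 3" for k
  proof -
    have "(1 / 3 :: real) ^ i * (1 / 3) ^ (k - i) = (1 / 3) ^ k" if "i \<le> k" for i
      using that by (simp only: power_add[symmetric] le_add_diff_inverse)
    then have "(\<Sum>i\<le>k. a i * a (k - i)) = real (\<Sum>i\<le>k. M i * M (k - i)) * (1 / 3) ^ k"
      unfolding of_nat_sum sum_distrib_right by (intro sum.cong) (simp_all add: a_def)
    moreover have "of_bool (k = 0) = of_bool (k = 0) * (1 / 3 :: real) ^ k"
      by (cases "k = 0") simp_all
    moreover have "a (Suc k)
        = (of_bool (k = 0) + real (M k) + real (\<Sum>i\<le>k. M i * M (k - i))) * (1 / 3) ^ k / 3"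
      by (simp add: a_def M_Suc)
    ultimately show ?thesis
      unfolding a_def[of k] distrib_right by presburger
  qed
  \<comment> \<open>Enlarging the triangle i + j <= n to a full square bounds the convolutions by
    the squared partial sum, and (1 + y + y^2) / 3 <= 1 whenever 0 <= y <= 1.\<close>
  have bound: "(\<Sum>k\<le>n. a k) \<le> 1" for n
  proof (induction n)
    case 0
    then show ?case by (simp add: a_0)
  next
    case (Suc n)
    let ?P = "\<Sum>k\<le>n. a k"
    have "(\<Sum>k\<le>n. \<Sum>i\<le>k. a i * a (k - i)) = (\<Sum>(i, j)\<in>{(i, j). i + j \<le> n}. a i * a j)"
      by (simp add: sum.triangle_reindex_eq)
    also have "\<dots> \<le> (\<Sum>(i, j)\<in>{..n} \<times> {..n}. a i * a j)"
      by (rule sum_mono2) (auto simp: a_nonneg)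
    also have "\<dots> = ?P * ?P"
      by (simp add: sum_product sum.cartesian_product)
    also have "\<dots> \<le> 1"
      using Suc by (intro mult_le_one sum_nonneg a_nonneg)
    finally have "(\<Sum>k\<le>n. \<Sum>i\<le>k. a i * a (k - i)) \<le> 1" .
    moreover have "(\<Sum>k\<le>Suc n. a k) = (1 + ?P + (\<Sum>k\<le>n. \<Sum>i\<le>k. a i * a (k - i))) / 3"
      by (simp add: sum.atMost_Suc_shift a_0 a_Suc sum.distrib flip: sum_divide_distrib del: sum.atMost_Suc)
    ultimately show ?case using Suc by simp
  qed
  have summable: "summable a"
  proof (rule summableI_nonneg_bounded)
    show "(\<Sum>k<n. a k) \<le> 1" for n
      using bound[of n] sum_mono2[of "{..n}" "{..<n}" a] a_nonneg by fastforce
  qed (rule a_nonneg)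
  define s where "s = suminf a"
  have a_sums: "a sums s"
    using summable by (simp add: s_def summable_sums)
  have "(\<lambda>k. \<Sum>i\<le>k. a i * a (k - i)) sums (s * s)"
    unfolding s_def by (rule Cauchy_product_sums) (use summable a_nonneg in simp_all)
  moreover have "(\<lambda>k. of_bool (k = 0) :: real) sums 1"
    using sums_single[of 0 "\<lambda>_. 1 :: real"] by (simp add: of_bool_def)
  ultimately have "(\<lambda>k. a (Suc k)) sums ((1 + s + s * s) / 3)"
    unfolding a_Suc by (intro sums_divide sums_add a_sums)
  moreover have tail: "(\<lambda>k. a (Suc k)) sums s"
    using a_sums a_0 sums_Suc_iff[of a s] by simp
  ultimately have "s = (1 + s + s * s) / 3"
    by (rule sums_unique2[symmetric])
  then have "(s - 1)\<^sup>2 = 0"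
    by (simp add: power2_eq_square algebra_simps)
  then show ?thesis
    using tail by (simp add: a_def)
qed

theorem mainTheorem9:
  shows "(\<forall>k\<ge>1. Abs_fps (\<lambda>n. if n \<ge> 1 then real (total_count n k) else 0)
            = fps_const (real (M k)) * fps_X ^ k / sqrt_series)
       \<and> (\<forall>k\<ge>1.
            (\<forall>n\<ge>1. measure_pmf.prob (random_vertex n) {(t, v). subtree_size t v = k}
                      = real (total_count n k) / (real n * real (M n)))
          \<and> (\<lambda>n. measure_pmf.prob (random_vertex n) {(t, v). subtree_size t v = k})
              \<longlonglongrightarrow> real (M k) * (1 / 3) ^ k)
       \<and> (\<lambda>k. real (M (Suc k)) * (1 / 3) ^ Suc k) sums 1"
proof (intro conjI allI impI)
  fix k :: nat assume k: "k \<ge> 1"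
  have "Abs_fps (\<lambda>n. if n \<ge> 1 then real (total_count n k) else 0) = count_fps k"
    by (rule fps_ext) (auto simp: count_fps_def total_count_0 not_less_eq_eq)
  then show "Abs_fps (\<lambda>n. if n \<ge> 1 then real (total_count n k) else 0)
      = fps_const (real (M k)) * fps_X ^ k / sqrt_series"
    using count_fps_closed_form[OF k] by simp
next
  fix k n :: nat assume "n \<ge> 1"
  then show "measure_pmf.prob (random_vertex n) {(t, v). subtree_size t v = k}
      = real (total_count n k) / (real n * real (M n))"
    by (rule prob_subtree_size)
next
  fix k :: nat assume k: "k \<ge> 1"
  \<comment> \<open>The formula for the probability is available from n = 1 on, which is enough for
    a limit.\<close>
  have "\<forall>\<^sub>F n in sequentially. real (total_count n k) / (real n * real (M n))
      = measure_pmf.prob (random_vertex n) {(t, v). subtree_size t v = k}"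
    by (intro eventually_sequentiallyI[of 1]) (simp add: prob_subtree_size)
  then show "(\<lambda>n. measure_pmf.prob (random_vertex n) {(t, v). subtree_size t v = k})
      \<longlonglongrightarrow> real (M k) * (1 / 3) ^ k"
    by (rule Lim_transform_eventually[OF vertex_fraction_tendsto[OF k]])
qed (rule M_third_sums)

end
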